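(* Let $p$ be an odd prime, $1\le m<n$, $\bar B\subseteq[n]\setminus[m]$ with $|\bar B|=b$ and $1\le b\le n-m$. Let $I$ be the saturated generalized order ideal of $\mathbb{GH}(m,n)$ in which every element of $[m]\cup\bar B$ has multiplicity $p-1$ and all other elements have multiplicity $0$, and let $D=\mathbb{F}_p^n\setminus I(\mathbb{GP})$ (saturated notion). Put $Q=(p-1)p^{n-1}$, $c_1=p^{n-m-b}$, $c_0=p^{n-m}-p^{n-m-b}$. Write $u=(v,w)$ with $v\in\mathbb{F}_p^m$, $w\in\mathbb{F}_p^{n-m}$, $\sigma=\sum_{i\le m}v_i\in\mathbb{F}_p$, and $\delta=1$ if the restriction $w_{\bar B}$ of $w$ to the coordinates in $\bar B$ is zero, $\delta=0$ otherwise. Then $\mathcal{C}_D$ is an $[p^n-p^m-p^b+1,\ n]$ code over $\mathbb{F}_p$ with at most six nonzero weights, and for $u\neq0$ the weight of $c_D(u)$, together with the number of nonzero $u$ satisfying each condition, is as follows: \[ \begin{array}{lll} \text{condition on }u=(v,w) & \text{weight} & \text{frequency}\\ v=0,\ \delta=1 & Q & c_1-1\\ v=0,\ \delta=0 & (p-1)(p^{n-1}-p^{b-1}) & c_0\\ v\ne0,\ \sigma=0,\ \delta=1 & (p-1)(p^{n-1}-p^{m-1}) & (p^{m-1}-1)c_1\\ v\ne0,\ \sigma=0,\ \delta=0 & (p-1)(p^{n-1}-p^{m-1}-p^{b-1}) & (p^{m-1}-1)c_0\\ \sigma\ne0,\ \delta=1 & (p-1)(p^{n-1}-p^{m-1})-p^b+1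 & (p^m-p^{m-1})c_1\\ \sigma\ne0,\ \delta=0 & (p-1)(p^{n-1}-p^{m-1}-p^{b-1})+1 & (p^m-p^{m-1})c_0 \end{array} \]
   Context: $[n]=\{1,\dots,n\}$. For $D\subseteq\mathbb{F}_p^n$ the code is $\mathcal{C}_D=\{c_D(u)=(u\cdot x)_{x\in D}:u\in\mathbb{F}_p^n\}$, where $u\cdot x=\sum_i u_ix_i$. An $[N,k]$ code is a linear code of length $N$ and dimension $k$; weights are Hamming weights. Generalized order ideals: $[n]_{p-1}$ is the multiset in which each $i\in[n]$ has multiplicity $p-1$. A sub-multiset $J$ is identified with its multiplicity vector $(J_1,\dots,J_n)\in\{0,\dots,p-1\}^n=\mathbb{F}_p^n$; $J\subseteq J'$ means $J_i\le J'_i$ (as integers) for all $i$; $\bar J=\{i:J_i\ne0\}$ is the support. The hierarchical poset $\mathbb{H}(m,n)$ on $[n]$ has as its only strict relations $i\prec j$ for all $i\in[m]$, $j\in[n]\setminus[m]$; $\mathbb{GH}(m,n)$ denotes $[n]_{p-1}$ together with this order. $J$ is a saturated generalized order ideal if $\bar J$ is an order ideal (down-closed subset) of $\mathbb{H}(m,n)$ and $J_i=p-1$ whenever $j\in\bar J$ and $i\prec j$. For a saturated generalized order ideal $I$, $I(\mathbb{GP})\subseteq\mathbb{F}_p^n$ is the set of all saturated generalized order ideals contained in $I$. *)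

theory Defs
  imports
    Complex_Main
    "HOL-Library.Function_Algebras"
    "HOL-Library.Multiset"
    "Berlekamp_Zassenhaus.Finite_Field"
begin

(* The space F^S of families indexed by S, represented by the functions that vanish outside S.
   It serves both for F_p^n, with S = {1..n}, and for words of length card D, with S = D. *)
definition fspace :: "'i set \<Rightarrow> ('i \<Rightarrow> 'a::zero) set" where
  "fspace S = {f. \<forall>i. i \<notin> S \<longrightarrow> f i = 0}"

(* The component of f in the coordinates in A; the other coordinates are set to 0, so that
   proj A f lies in fspace A. *)
definition proj :: "'i set \<Rightarrow> ('i \<Rightarrow> 'a::zero) \<Rightarrow> 'i \<Rightarrow> 'a" where
  "proj A f = (\<lambda>i. if i \<in> A then f i else 0)"

definition fscale :: "'a::field \<Rightarrow> ('i \<Rightarrow> 'a) \<Rightarrow> 'i \<Rightarrow> 'a" where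
  "fscale a f = (\<lambda>i. a * f i)"

interpretation fun_space: vector_space "fscale :: 'a::field \<Rightarrow> ('i \<Rightarrow> 'a) \<Rightarrow> 'i \<Rightarrow> 'a"
  by unfold_locales (auto simp: fscale_def fun_eq_iff algebra_simps)

definition hamming_weight :: "('i \<Rightarrow> 'a::zero) \<Rightarrow> nat" where
  "hamming_weight c = card {x. c x \<noteq> 0}"

(* C is an [N,k] code whose coordinates are indexed by S. *)
definition is_code :: "'i set \<Rightarrow> nat \<Rightarrow> nat \<Rightarrow> ('i \<Rightarrow> 'a::field) set \<Rightarrow> bool" where
  "is_code S N k C \<longleftrightarrow>
     finite S \<and> card S = N \<and>
     C \<subseteq> fspace S \<and> fun_space.subspace C \<and> fun_space.dim C = k"

definition dot :: "nat \<Rightarrow> (nat \<Rightarrow> 'a::field) \<Rightarrow> (nat \<Rightarrow> 'a) \<Rightarrow> 'a" where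
  "dot n u x = (\<Sum>i\<in>{1..n}. u i * x i)"

definition codeword :: "nat \<Rightarrow> (nat \<Rightarrow> 'a::field) set \<Rightarrow> (nat \<Rightarrow> 'a) \<Rightarrow> (nat \<Rightarrow> 'a) \<Rightarrow> 'a" where
  "codeword n D u = (\<lambda>x. if x \<in> D then dot n u x else 0)"

definition code :: "nat \<Rightarrow> (nat \<Rightarrow> 'a::field) set \<Rightarrow> ((nat \<Rightarrow> 'a) \<Rightarrow> 'a) set" where
  "code n D = codeword n D ` fspace {1..n}"

(* Strict order of the hierarchical poset H(m,n). *)
definition hier :: "nat \<Rightarrow> nat \<Rightarrow> nat \<Rightarrow> nat \<Rightarrow> bool" where
  "hier m n i j \<longleftrightarrow> i \<in> {1..m} \<and> j \<in> {1..n} - {1..m}"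

definition order_ideal :: "(nat \<Rightarrow> nat \<Rightarrow> bool) \<Rightarrow> nat \<Rightarrow> nat set \<Rightarrow> bool" where
  "order_ideal lt n A \<longleftrightarrow> A \<subseteq> {1..n} \<and> (\<forall>i\<in>{1..n}. \<forall>j\<in>A. lt i j \<longrightarrow> i \<in> A)"

(* J is a sub-multiset of the multiset in which every i in {1..n} has multiplicity p - 1. *)
definition sat_ideal :: "nat \<Rightarrow> (nat \<Rightarrow> nat \<Rightarrow> bool) \<Rightarrow> nat \<Rightarrow> nat multiset \<Rightarrow> bool" where
  "sat_ideal p lt n J \<longleftrightarrow>
     J \<subseteq># repeat_mset (p - 1) (mset_set {1..n}) \<and>
     order_ideal lt n (set_mset J) \<and>
     (\<forall>i\<in>{1..n}. \<forall>j\<in>set_mset J. lt i j \<longrightarrow> count J i = p - 1)"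

(* Multiplicity vector, read modulo the characteristic. This is injective on multisets with all
   multiplicities at most p - 1 when the field has p elements. *)
definition mult_vec :: "nat multiset \<Rightarrow> nat \<Rightarrow> 'a::field" where
  "mult_vec J = (\<lambda>i. of_nat (count J i))"

definition ideal_vectors ::
    "(nat \<Rightarrow> nat \<Rightarrow> bool) \<Rightarrow> nat \<Rightarrow> nat multiset \<Rightarrow> (nat \<Rightarrow> 'p::prime_card mod_ring) set" where
  "ideal_vectors lt n I = mult_vec ` {J. sat_ideal CARD('p) lt n J \<and> J \<subseteq># I}"

(* One row of a weight table: every nonzero u satisfying P gives a codeword of weight w, and
   there are f such u. Both w and f are integers so that no subtraction is truncated. *)
definition weight_row ::
    "nat \<Rightarrow> (nat \<Rightarrow> 'a::field) set \<Rightarrow> ((nat \<Rightarrow> 'a) \<Rightarrow> bool) \<Rightarrow> int \<Rightarrow> int \<Rightarrow> bool" where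
  "weight_row n D P w f \<longleftrightarrow>
     (\<forall>u\<in>fspace {1..n}. u \<noteq> 0 \<and> P u \<longrightarrow> int (hamming_weight (codeword n D u)) = w) \<and>
     int (card {u \<in> fspace {1..n}. u \<noteq> 0 \<and> P u}) = f"

end

theory Submission
  imports Defs
begin

text \<open>Put \<open>M = {1..m}\<close> and \<open>s = (\<Sum>i\<in>M. u i)\<close>. A saturated ideal below \<open>I\<close> is either
  supported in \<open>M\<close>, with arbitrary multiplicities there, or it meets \<open>B\<close>, and saturation then
  forces multiplicity \<open>p - 1\<close>, the residue \<open>-1\<close>, at every element of \<open>M\<close>. The vectors removed
  from \<open>F_p^n\<close> are therefore the coordinate space \<open>F_p^M\<close> together with the vectors
  \<open>(-1, ..., -1, y)\<close> for nonzero \<open>y \<in> F_p^B\<close>: this is \<open>ideal_vectors_hier\<close>.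

  On these two families the linear form \<open>u\<close> becomes a linear form on \<open>F_p^M\<close>, and the affine
  form \<open>y \<mapsto> (\<Sum>i\<in>B. u i * y i) - s\<close>. A linear form that is not identically zero
  takes each value equally often (\<open>card_hyperplane\<close>), so the weight of the codeword of
  a nonzero \<open>u\<close> depends only on whether \<open>u\<close> vanishes on \<open>M\<close>, whether it vanishes on \<open>B\<close>, and whether \<open>s = 0\<close>
  (\<open>hamming_weight_codeword_cases\<close>). The frequencies follow by choosing the components of \<open>u\<close> in
  \<open>M\<close> and outside \<open>M\<close> independently (\<open>card_fspace_split\<close>).

  For the dimension it suffices that nonzero \<open>u\<close> have nonzero weight, since then the encoding is
  injective. At least \<open>p^n - p^(n-1) \<ge> 2 p^(n-1)\<close> points of \<open>F_p^n\<close> lie off the kernel of \<open>u\<close>, as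
  \<open>p \<ge> 3\<close>, and fewer than \<open>p^m + p^b \<le> 2 p^(n-1)\<close> of them are removed
  (\<open>hamming_weight_codeword_pos\<close>).\<close>

section \<open>Counting in coordinate spaces over a finite field\<close>

lemma finite_fspace:
  assumes "finite S"
  shows "finite (fspace S :: ('i \<Rightarrow> 'a::{zero,finite}) set)"
proof -
  have "fspace S = {f :: 'i \<Rightarrow> 'a. \<forall>i. (i \<in> S \<longrightarrow> f i \<in> UNIV) \<and> (i \<notin> S \<longrightarrow> f i = 0)}"
    by (simp add: fspace_def)
  then show ?thesis
    using finite_set_of_finite_funs[OF assms, of UNIV "0 :: 'a"] by simp
qed

lemma card_fspace:
  assumes "finite S"
  shows "card (fspace S :: ('i \<Rightarrow> 'a::{zero,finite}) set) = CARD('a) ^ card S"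
proof -
  have "bij_betw (\<lambda>f. restrict f S) (fspace S :: ('i \<Rightarrow> 'a) set) (S \<rightarrow>\<^sub>E UNIV)"
    by (rule bij_betw_byWitness[where f' = "proj S"])
       (auto simp: fspace_def proj_def fun_eq_iff PiE_def extensional_def)
  then show ?thesis
    using card_PiE[OF assms, of "\<lambda>_. UNIV :: 'a set"] by (simp add: bij_betw_same_card)
qed

lemma zero_in_fspace [simp]: "0 \<in> fspace S"
  by (simp add: fspace_def)

lemma fspace_mono: "S \<subseteq> T \<Longrightarrow> fspace S \<subseteq> fspace T"
  by (auto simp: fspace_def)

lemma fspace_eq_0_iff: "f \<in> fspace S \<Longrightarrow> f = 0 \<longleftrightarrow> (\<forall>i\<in>S. f i = 0)"
  by (auto simp: fspace_def fun_eq_iff)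

lemma proj_eq_0_iff: "proj S f = 0 \<longleftrightarrow> (\<forall>i\<in>S. f i = 0)"
  by (auto simp: proj_def fun_eq_iff)

text \<open>A nonzero coefficient in position \<open>j\<close> makes the coordinate \<open>x j\<close> a function of
  the remaining ones, so an affine hyperplane is in bijection with a coordinate space of one
  dimension less.\<close>
lemma card_hyperplane:
  fixes a :: "'i \<Rightarrow> 'a::{field,finite}"
  assumes S: "finite S" "j \<in> S" and j: "a j \<noteq> 0"
  shows "card {x \<in> fspace S. (\<Sum>i\<in>S. a i * x i) = t} = CARD('a) ^ (card S - 1)"
proof -
  have split: "(\<Sum>i\<in>S. a i * x i) = a j * x j + (\<Sum>i\<in>S - {j}. a i * x i)" for x
    using S by (simp add: sum.remove)
  have upd: "(\<Sum>i\<in>S - {j}. a i * (if i = j then c else x i)) = (\<Sum>i\<in>S - {j}. a i * x i)" for c x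
    by (rule sum.cong) auto
  have "bij_betw (\<lambda>x. x(j := 0)) {x \<in> fspace S. (\<Sum>i\<in>S. a i * x i) = t} (fspace (S - {j}))"
    by (rule bij_betw_byWitness
        [where f' = "\<lambda>y. y(j := (t - (\<Sum>i\<in>S - {j}. a i * y i)) / a j)"])
       (use S j in \<open>auto simp: split upd fspace_def fun_eq_iff\<close>)
  then have "card {x \<in> fspace S. (\<Sum>i\<in>S. a i * x i) = t}
      = card (fspace (S - {j}) :: ('i \<Rightarrow> 'a) set)"
    by (rule bij_betw_same_card)
  with S show ?thesis
    by (simp add: card_fspace)
qed

text \<open>The number of points of the coordinate space over \<open>S\<close> at which the linear form with
  coefficients \<open>a\<close> does not take the value \<open>t\<close>. The form is allowed to vanish identically.\<close>
definition off_count :: "'i set \<Rightarrow> ('i \<Rightarrow> 'a::field) \<Rightarrow> 'a \<Rightarrow> nat" where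
  "off_count S a t = card {x \<in> fspace S. (\<Sum>i\<in>S. a i * x i) \<noteq> t}"

lemma off_count_eq:
  fixes a :: "'i \<Rightarrow> 'a::{field,finite}"
  assumes "finite S"
  shows "int (off_count S a t) =
    (if \<exists>j\<in>S. a j \<noteq> 0 then int CARD('a) ^ card S - int CARD('a) ^ (card S - 1)
     else if t = 0 then 0 else int CARD('a) ^ card S)"
proof (cases "\<exists>j\<in>S. a j \<noteq> 0")
  case True
  then obtain j where j: "j \<in> S" "a j \<noteq> 0" by blast
  let ?H = "{x \<in> fspace S. (\<Sum>i\<in>S. a i * x i) = t}"
  have "{x \<in> fspace S. (\<Sum>i\<in>S. a i * x i) \<noteq> t} = fspace S - ?H"
    by auto
  moreover have fin: "finite (fspace S :: ('i \<Rightarrow> 'a) set)"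
    by (rule finite_fspace) fact
  moreover have "card ?H \<le> card (fspace S :: ('i \<Rightarrow> 'a) set)"
    by (rule card_mono[OF fin]) auto
  ultimately have "int (off_count S a t) = int (card (fspace S :: ('i \<Rightarrow> 'a) set)) - int (card ?H)"
    by (simp add: off_count_def card_Diff_subset of_nat_diff)
  with True show ?thesis
    by (simp add: card_hyperplane[where j = j] card_fspace assms j)
next
  case False
  then have "{x \<in> fspace S. (\<Sum>i\<in>S. a i * x i) \<noteq> t} = (if t = 0 then {} else fspace S)"
    by auto
  then show ?thesis
    using False assms by (auto simp: off_count_def card_fspace)
qed

text \<open>The components of a vector in two disjoint sets of coordinates are independent.\<close>
lemma card_fspace_split:
  assumes "S \<inter> T = {}"
  shows "card {u \<in> fspace (S \<union> T). P (proj S u) \<and> R (proj T u)}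
    = card {v \<in> fspace S. P v} * card {w \<in> fspace T. R w}"
proof -
  let ?glue = "\<lambda>(v, w) i. if i \<in> S then v i else w i"
  have S: "proj S (?glue (v, w)) = v" if "v \<in> fspace S" for v w
    using that by (auto simp: fspace_def proj_def fun_eq_iff)
  have T: "proj T (?glue (v, w)) = w" if "w \<in> fspace T" for v w
    using that assms by (auto simp: fspace_def proj_def fun_eq_iff)
  have "bij_betw (\<lambda>u. (proj S u, proj T u)) {u \<in> fspace (S \<union> T). P (proj S u) \<and> R (proj T u)}
      ({v \<in> fspace S. P v} \<times> {w \<in> fspace T. R w})"
  proof (rule bij_betw_byWitness[where f' = ?glue])
    show "\<forall>u\<in>{u \<in> fspace (S \<union> T). P (proj S u) \<and> R (proj T u)}. ?glue (proj S u, proj T u) = u"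
      by (auto simp: fspace_def proj_def fun_eq_iff)
    show "\<forall>z\<in>{v \<in> fspace S. P v} \<times> {w \<in> fspace T. R w}. (proj S (?glue z), proj T (?glue z)) = z"
      using S T by auto
    show "(\<lambda>u. (proj S u, proj T u)) ` {u \<in> fspace (S \<union> T). P (proj S u) \<and> R (proj T u)}
        \<subseteq> {v \<in> fspace S. P v} \<times> {w \<in> fspace T. R w}"
      by (auto simp: fspace_def proj_def)
    show "?glue ` ({v \<in> fspace S. P v} \<times> {w \<in> fspace T. R w})
        \<subseteq> {u \<in> fspace (S \<union> T). P (proj S u) \<and> R (proj T u)}"
    proof (rule image_subsetI)
      fix z assume "z \<in> {v \<in> fspace S. P v} \<times> {w \<in> fspace T. R w}"
      then obtain v w where z: "z = (v, w)" "v \<in> fspace S" "P v" "w \<in> fspace T" "R w" by blast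
      then have "?glue z \<in> fspace (S \<union> T)"
        by (auto simp: fspace_def)
      with z show "?glue z \<in> {u \<in> fspace (S \<union> T). P (proj S u) \<and> R (proj T u)}"
        using S[of v w] T[of w v] by simp
    qed
  qed
  then show ?thesis
    by (simp add: bij_betw_same_card card_cartesian_product)
qed

section \<open>The dimension of a code with injective encoding\<close>

lemma dot_add: "dot n (u + v) x = dot n u x + dot n v x"
  by (simp add: dot_def algebra_simps sum.distrib)

lemma dot_fscale: "dot n (fscale c u) x = c * dot n u x"
  by (simp add: dot_def fscale_def sum_distrib_left mult.assoc)

lemma linear_codeword: "Vector_Spaces.linear fscale fscale (codeword n D)"
  by unfold_locales
     (auto simp: codeword_def fun_eq_iff dot_add dot_fscale,
      auto simp: fscale_def algebra_simps dot_fscale[unfolded fscale_def])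

lemma subspace_fspace: "fun_space.subspace (fspace S)"
  by (auto simp: fun_space.subspace_def fspace_def fscale_def)

lemma dim_fspace:
  assumes "finite S"
  shows "fun_space.dim (fspace S :: ('i \<Rightarrow> 'a::field) set) = card S"
proof -
  \<comment> \<open>The unit vectors form a basis.\<close>
  define e :: "'i \<Rightarrow> 'i \<Rightarrow> 'a" where "e i = (\<lambda>k. if k = i then 1 else 0)" for i
  have inj: "inj_on e S"
    by (rule inj_onI) (metis e_def zero_neq_one)
  have coord: "(\<Sum>i\<in>S. fscale (c i) (e i)) k = (if k \<in> S then c k else 0)" for c k
  proof -
    have "(\<Sum>i\<in>S. fscale (c i) (e i)) k = (\<Sum>i\<in>S. fscale (c i) (e i) k)"
      by (induction S rule: infinite_finite_induct) auto
    also have "\<dots> = (\<Sum>i\<in>S. if k = i then c i else 0)"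
      by (rule sum.cong) (auto simp: fscale_def e_def)
    finally show ?thesis using assms by simp
  qed
  have indep: "fun_space.independent (e ` S)"
  proof (rule fun_space.independent_if_scalars_zero)
    fix f x assume 0: "(\<Sum>x\<in>e ` S. fscale (f x) x) = 0" and "x \<in> e ` S"
    then obtain k where k: "k \<in> S" "x = e k" by blast
    have "(\<Sum>i\<in>S. fscale (f (e i)) (e i)) = 0"
      using 0 by (simp add: sum.reindex[OF inj] comp_def)
    then show "f x = 0"
      using coord[of "\<lambda>i. f (e i)" k] k by simp
  qed (use assms in simp)
  have "fspace S \<subseteq> fun_space.span (e ` S)"
  proof
    fix f :: "'i \<Rightarrow> 'a" assume "f \<in> fspace S"
    then have "f = (\<Sum>i\<in>S. fscale (f i) (e i))"
      by (auto simp: fun_eq_iff coord fspace_def)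
    also have "\<dots> \<in> fun_space.span (e ` S)"
      by (intro fun_space.span_sum fun_space.span_scale fun_space.span_base imageI)
    finally show "f \<in> fun_space.span (e ` S)" .
  qed
  then have "fun_space.dim (fspace S :: ('i \<Rightarrow> 'a) set) = card (e ` S)"
    using indep by (intro fun_space.basis_card_eq_dim[symmetric]) (auto simp: fspace_def e_def)
  then show ?thesis
    using card_image[OF inj] by simp
qed

text \<open>The length is the cardinality of the defining set; the dimension is \<open>n\<close> as soon as only
  \<open>u = 0\<close> is encoded as the zero word.\<close>
lemma is_code_code:
  fixes D :: "(nat \<Rightarrow> 'a::field) set"
  assumes "finite D"
    and ker: "\<And>u. u \<in> fspace {1..n} \<Longrightarrow> codeword n D u = 0 \<Longrightarrow> u = 0"
  shows "is_code D (card D) n (code n D)"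
proof -
  interpret cw: Vector_Spaces.linear fscale fscale "codeword n D"
    by (rule linear_codeword)
  have sub: "fun_space.subspace (code n D)"
    unfolding code_def by (rule cw.subspace_image) (rule subspace_fspace)
  have inj: "inj_on (codeword n D) (fspace {1..n})"
    using cw.inj_on_iff_eq_0[OF subspace_fspace] ker by blast
  obtain E :: "(nat \<Rightarrow> 'a) set" where E: "E \<subseteq> fspace {1..n}" "fun_space.independent E"
      "fspace {1..n} \<subseteq> fun_space.span E" "card E = fun_space.dim (fspace {1..n} :: (nat \<Rightarrow> 'a) set)"
    by (rule fun_space.basis_exists)
  have span: "fun_space.span E = fspace {1..n}"
    using E by (intro fun_space.span_subspace subspace_fspace) auto
  have "fun_space.independent (codeword n D ` E)"
    using cw.independent_injective_image[OF E(2)] inj by (simp add: span)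
  moreover have "fun_space.span (codeword n D ` E) = code n D"
    by (simp add: cw.span_image span code_def)
  ultimately have "fun_space.dim (code n D) = card (codeword n D ` E)"
    using fun_space.dim_eq_card[of "codeword n D ` E" "code n D"] fun_space.span_eq_iff sub by metis
  also have "\<dots> = card E"
    by (rule card_image) (use inj E in \<open>auto intro: inj_on_subset\<close>)
  also have "\<dots> = n"
    using E by (simp add: dim_fspace)
  finally have "fun_space.dim (code n D) = n" .
  moreover have "code n D \<subseteq> fspace D"
    by (auto simp: code_def fspace_def codeword_def)
  ultimately show ?thesis
    using sub assms by (simp add: is_code_def)
qed

section \<open>The vectors below the ideal\<close>

text \<open>The vector equal to \<open>-1\<close>, the residue of the full multiplicity, on \<open>M\<close> and to \<open>y\<close>
  elsewhere.\<close>
definition fill :: "nat set \<Rightarrow> (nat \<Rightarrow> 'a::field) \<Rightarrow> nat \<Rightarrow> 'a" where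
  "fill M y = (\<lambda>i. if i \<in> M then - 1 else y i)"

lemma of_nat_mod_ring_eq_0D:
  assumes "k < CARD('p)" "of_nat k = (0 :: 'p::prime_card mod_ring)"
  shows "k = 0"
  using of_nat_0_mod_ring_dvd[OF assms(2)] assms(1) by (auto dest: dvd_imp_le)

lemma of_nat_card_minus_1: "of_nat (CARD('p) - 1) = (- 1 :: 'p::prime_card mod_ring)"
proof -
  have "of_nat (CARD('p) - 1) + (1 :: 'p mod_ring) = of_nat (CARD('p) - 1 + 1)"
    by (simp only: of_nat_add of_nat_1)
  also have "\<dots> = (0 :: 'p mod_ring)"
    by simp
  finally show ?thesis
    by (simp add: eq_neg_iff_add_eq_0)
qed

text \<open>Every vector with finite support is the multiplicity vector of a multiset with
  multiplicities below the field size; the multiplicities are the least residues.\<close>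
lemma mult_vec_surj:
  fixes x :: "nat \<Rightarrow> 'p::prime_card mod_ring"
  assumes "finite S" "x \<in> fspace S"
  shows "\<exists>J. mult_vec J = x \<and> (\<forall>i. count J i \<le> CARD('p) - 1 \<and> (count J i = 0 \<longleftrightarrow> x i = 0))"
proof -
  have "\<forall>i. \<exists>k. k < CARD('p) \<and> x i = of_nat k"
    using surj_of_nat_mod_ring by blast
  then obtain r where r: "\<And>i. r i < CARD('p)" "\<And>i. x i = of_nat (r i)"
    by metis
  have r0: "r i = 0 \<longleftrightarrow> x i = 0" for i
    using r of_nat_mod_ring_eq_0D by (metis of_nat_0)
  have "{i. 0 < r i} \<subseteq> S"
    using assms r0 by (auto simp: fspace_def) (metis neq0_conv)
  then have "finite {i. 0 < r i}"
    using assms(1) finite_subset by blast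
  then have "count (Abs_multiset r) = r"
    by (simp add: count_Abs_multiset)
  then show ?thesis
    using r r0 by (intro exI[of _ "Abs_multiset r"])
      (auto simp: mult_vec_def fun_eq_iff less_Suc_eq_le[symmetric])
qed

text \<open>A saturated ideal below \<open>I\<close> either lives on the bottom level \<open>M = {1..m}\<close>, where no
  relation constrains it, or it meets \<open>B\<close> and is then forced to have full multiplicity on \<open>M\<close>.\<close>
lemma ideal_vectors_hier:
  fixes I :: "nat multiset"
  assumes "m < n" and B: "B \<subseteq> {1..n} - {1..m}"
    and full: "\<forall>i \<in> {1..m} \<union> B. count I i = CARD('p) - 1"
    and zero: "\<forall>i. i \<notin> {1..m} \<union> B \<longrightarrow> count I i = 0"
  shows "(ideal_vectors (hier m n) n I :: (nat \<Rightarrow> 'p::prime_card mod_ring) set)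
    = fspace {1..m} \<union> fill {1..m} ` (fspace B - {0})"
proof (intro equalityI subsetI)
  fix x :: "nat \<Rightarrow> 'p mod_ring" assume "x \<in> ideal_vectors (hier m n) n I"
  then obtain J where J: "sat_ideal CARD('p) (hier m n) n J" "J \<subseteq># I" and x: "x = mult_vec J"
    by (auto simp: ideal_vectors_def)
  have le: "count J i \<le> count I i" for i
    using J(2) by (rule mset_subset_eq_count)
  have out: "x i = 0" if "i \<notin> {1..m} \<union> B" for i
    using le[of i] zero that by (simp add: x mult_vec_def)
  show "x \<in> fspace {1..m} \<union> fill {1..m} ` (fspace B - {0})"
  proof (cases "\<exists>j\<in>B. count J j \<noteq> 0")
    case True
    then obtain j where j: "j \<in> B" "count J j \<noteq> 0" by blast
    then have "j \<in># J" by simp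
    have "count J i = CARD('p) - 1" if "i \<in> {1..m}" for i
    proof -
      have "hier m n i j" "i \<in> {1..n}"
        using that j B \<open>m < n\<close> by (auto simp: hier_def)
      with \<open>j \<in># J\<close> J(1) show ?thesis
        unfolding sat_ideal_def by blast
    qed
    then have bottom: "x i = - 1" if "i \<in> {1..m}" for i
      using that by (simp only: x mult_vec_def of_nat_card_minus_1)
    have "count J j < CARD('p)"
      using le[of j] full j nontriv[where 'a = 'p] by simp
    then have "x j \<noteq> 0"
      using of_nat_mod_ring_eq_0D[of "count J j", where 'p = 'p] j(2) by (auto simp: x mult_vec_def)
    then have "proj B x \<in> fspace B - {0}"
      using j by (auto simp: proj_eq_0_iff) (simp add: fspace_def proj_def)
    moreover have "x = fill {1..m} (proj B x)"
      using bottom out by (auto simp: fill_def proj_def fun_eq_iff)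
    ultimately show ?thesis by blast
  next
    case False
    then have "x i = 0" if "i \<in> B" for i
    proof -
      have "count J i = 0" using False that by blast
      then show ?thesis by (simp only: x mult_vec_def of_nat_0)
    qed
    with out have "x \<in> fspace {1..m}"
      unfolding fspace_def by blast
    then show ?thesis by simp
  qed
next
  fix x :: "nat \<Rightarrow> 'p mod_ring"
  assume x: "x \<in> fspace {1..m} \<union> fill {1..m} ` (fspace B - {0})"
  then have supp: "x \<in> fspace ({1..m} \<union> B)"
    by (auto simp: fspace_def fill_def)
  have "finite ({1..m} \<union> B)"
    using B finite_subset by blast
  from mult_vec_surj[OF this supp]
  obtain J where J': "mult_vec J = x" "\<forall>i. count J i \<le> CARD('p) - 1 \<and> (count J i = 0 \<longleftrightarrow> x i = 0)"
    by blast
  then have J: "mult_vec J = x" "count J i \<le> CARD('p) - 1" "count J i = 0 \<longleftrightarrow> x i = 0" for i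
    by simp_all
  have outJ: "count J i = 0" if "i \<notin> {1..m} \<union> B" for i
    using supp that J(3) by (auto simp: fspace_def)
  have sub: "{1..m} \<union> B \<subseteq> {1..n}"
    using B \<open>m < n\<close> by auto
  \<comment> \<open>If \<open>x\<close> is nonzero off the bottom level, then it has the form \<open>fill M y\<close>, so \<open>x i = - 1\<close> for
    \<open>i\<close> on the bottom level; the only multiplicity up to \<open>p - 1\<close> with residue \<open>- 1\<close> is \<open>p - 1\<close>.\<close>
  have bottom: "count J i = CARD('p) - 1" if "i \<in> {1..m}" "j \<in># J" "j \<notin> {1..m}" for i j
  proof -
    have "count J j \<noteq> 0"
      using that(2) by simp
    then have "x j \<noteq> 0"
      by (simp only: J(3)) simp
    then have "x \<notin> fspace {1..m}"
      using that(3) unfolding fspace_def by blast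
    then have "x i = - 1"
      using x that by (auto simp: fill_def)
    then have "of_nat (count J i + 1) = (0 :: 'p mod_ring)"
      using fun_cong[OF J(1), of i] by (simp add: mult_vec_def)
    then have "CARD('p) dvd count J i + 1"
      by (rule of_nat_0_mod_ring_dvd)
    then have "CARD('p) \<le> count J i + 1"
      by (rule dvd_imp_le) simp
    with J(2)[of i] show ?thesis by simp
  qed
  have "count J i \<le> count I i" for i
    using J(2)[of i] outJ[of i] full by (cases "i \<in> {1..m} \<union> B") simp_all
  then have "J \<subseteq># I"
    by (simp add: subseteq_mset_def)
  moreover have "sat_ideal CARD('p) (hier m n) n J"
    unfolding sat_ideal_def
  proof (intro conjI ballI impI)
    have "count J i \<le> count (repeat_mset (CARD('p) - 1) (mset_set {1..n})) i" for i
    proof (cases "i \<in> {1..n}")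
      case True
      with J(2)[of i] show ?thesis by simp
    next
      case False
      with sub have "i \<notin> {1..m} \<union> B" by blast
      from outJ[OF this] show ?thesis by simp
    qed
    then show "J \<subseteq># repeat_mset (CARD('p) - 1) (mset_set {1..n})"
      by (simp add: subseteq_mset_def)
    have pos: "CARD('p) - 1 > 0"
      using nontriv[where 'a = 'p] by simp
    show "order_ideal (hier m n) n (set_mset J)"
      unfolding order_ideal_def
    proof (intro conjI ballI impI subsetI)
      fix i assume "i \<in># J"
      then have "count J i \<noteq> 0" by simp
      with outJ have "i \<in> {1..m} \<union> B" by metis
      with sub show "i \<in> {1..n}" by blast
    next
      fix i j assume "j \<in># J" "hier m n i j"
      then have "count J i > 0"
        using bottom[of i j] pos by (auto simp: hier_def)
      then show "i \<in># J" by simp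
    qed
    fix i j assume "j \<in># J" "hier m n i j"
    then show "count J i = CARD('p) - 1"
      using bottom[of i j] by (auto simp: hier_def)
  qed
  ultimately show "x \<in> ideal_vectors (hier m n) n I"
    using J(1) by (auto simp: ideal_vectors_def)
qed

lemma fill_in_fspace:
  assumes "M \<subseteq> S" "B \<subseteq> S" "y \<in> fspace B"
  shows "fill M y \<in> fspace S"
proof -
  have "fill M y i = 0" if "i \<notin> S" for i
    using assms that by (auto simp: fill_def fspace_def)
  then show ?thesis
    by (simp add: fspace_def)
qed

lemma inj_on_fill:
  assumes "M \<inter> B = {}"
  shows "inj_on (fill M) (fspace B)"
proof (rule inj_onI, rule ext)
  fix x y :: "nat \<Rightarrow> 'a::field" and i
  assume xy: "x \<in> fspace B" "y \<in> fspace B" "fill M x = fill M y"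
  show "x i = y i"
    using fun_cong[OF xy(3), of i] xy(1,2) assms
    by (cases "i \<in> M"; cases "i \<in> B") (auto simp: fill_def fspace_def)
qed

lemma fill_notin_fspace:
  assumes "M \<inter> B = {}" "y \<in> fspace B - {0}"
  shows "fill M y \<notin> fspace M"
proof -
  obtain j where "j \<in> B" "y j \<noteq> 0"
    using assms(2) by (auto simp: fspace_eq_0_iff)
  with assms(1) show ?thesis
    by (auto simp: fspace_def fill_def)
qed

text \<open>The vector \<open>fill M 0\<close> already lies in \<open>fspace M\<close> and is counted once, hence the \<open>- 1\<close>.\<close>
lemma card_removed:
  assumes "finite M" "finite B" "M \<inter> B = {}"
  shows "int (card (fspace M \<union> fill M ` (fspace B - {0} :: (nat \<Rightarrow> 'a::{field,finite}) set)))
    = int CARD('a) ^ card M + int CARD('a) ^ card B - 1"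
proof -
  let ?F = "fill M ` (fspace B - {0} :: (nat \<Rightarrow> 'a) set)"
  have finB: "finite (fspace B :: (nat \<Rightarrow> 'a) set)"
    by (rule finite_fspace) fact
  have "inj_on (fill M) (fspace B - {0} :: (nat \<Rightarrow> 'a) set)"
    using inj_on_fill[OF assms(3)] by (rule inj_on_subset) auto
  then have "card ?F = CARD('a) ^ card B - 1"
    using finB assms by (simp add: card_image card_fspace)
  moreover have "card (fspace M \<union> ?F) = card (fspace M :: (nat \<Rightarrow> 'a) set) + card ?F"
    using finB fill_notin_fspace[OF assms(3)] assms(1)
    by (intro card_Un_disjoint) (auto simp: finite_fspace)
  ultimately show ?thesis
    using assms by (simp add: card_fspace of_nat_diff add_increasing)
qed

section \<open>Weights\<close>

text \<open>The full space contributes the first term, the removed coordinate space the second.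
  On a removed vector \<open>fill M y\<close> the form takes the value \<open>(\<Sum>i\<in>B. u i * y i) - (\<Sum>i\<in>M. u i)\<close>, whence
  the third term; the last one undoes the contribution of \<open>y = 0\<close>, which does not belong to
  the removed family but is counted by the third term when \<open>(\<Sum>i\<in>M. u i) \<noteq> 0\<close>.\<close>
lemma hamming_weight_codeword:
  fixes u :: "nat \<Rightarrow> 'a::{field,finite}"
  assumes M: "M \<subseteq> {1..n}" and B: "B \<subseteq> {1..n}" and disj: "M \<inter> B = {}"
    and D: "D = fspace {1..n} - (fspace M \<union> fill M ` (fspace B - {0}))"
  shows "int (hamming_weight (codeword n D u))
    = int (off_count {1..n} u 0) - int (off_count M u 0) - int (off_count B u (\<Sum>i\<in>M. u i))
      + (if (\<Sum>i\<in>M. u i) \<noteq> 0 then 1 else 0)"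
proof -
  let ?s = "\<Sum>i\<in>M. u i"
  let ?X = "{x \<in> fspace {1..n}. dot n u x \<noteq> 0}"
  let ?Y = "{x \<in> fspace M. dot n u x \<noteq> 0}"
  let ?Z = "{y \<in> fspace B. (\<Sum>i\<in>B. u i * y i) \<noteq> ?s}"
  have fin: "finite M" "finite B"
    using M B finite_subset by blast+
  have finB: "finite (fspace B :: (nat \<Rightarrow> 'a) set)"
    by (rule finite_fspace) fact
  have X: "card ?X = off_count {1..n} u 0"
    by (simp add: off_count_def dot_def)
  have "dot n u x = (\<Sum>i\<in>M. u i * x i)" if "x \<in> fspace M" for x
    unfolding dot_def using M that by (intro sum.mono_neutral_right) (auto simp: fspace_def)
  then have Y: "card ?Y = off_count M u 0"
    by (simp add: off_count_def cong: conj_cong)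
  have dot_fill: "dot n u (fill M y) = (\<Sum>i\<in>B. u i * y i) - ?s" if "y \<in> fspace B" for y
  proof -
    have "dot n u (fill M y) = (\<Sum>i\<in>M \<union> B. u i * fill M y i)"
      unfolding dot_def using M B that
      by (intro sum.mono_neutral_right) (auto simp: fspace_def fill_def)
    also have "\<dots> = (\<Sum>i\<in>M. u i * fill M y i) + (\<Sum>i\<in>B. u i * fill M y i)"
      using fin disj by (simp add: sum.union_disjoint)
    also have "(\<Sum>i\<in>M. u i * fill M y i) = - ?s"
      by (simp add: fill_def sum_negf)
    also have "(\<Sum>i\<in>B. u i * fill M y i) = (\<Sum>i\<in>B. u i * y i)"
      using disj by (intro sum.cong) (auto simp: fill_def)
    finally show ?thesis by simp
  qed
  have Z: "card (fill M ` (?Z - {0})) = card (?Z - {0})"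
    using inj_on_fill[OF disj] by (intro card_image) (auto intro: inj_on_subset)
  have removed: "{x \<in> fspace M \<union> fill M ` (fspace B - {0}). dot n u x \<noteq> 0}
      = ?Y \<union> fill M ` (?Z - {0})"
    using dot_fill by auto
  have subX: "?Y \<union> fill M ` (?Z - {0}) \<subseteq> ?X"
  proof -
    have "fspace M \<subseteq> (fspace {1..n} :: (nat \<Rightarrow> 'a) set)"
      using M by (rule fspace_mono)
    then show ?thesis
      using dot_fill fill_in_fspace[OF M B] by auto
  qed
  have finX: "finite ?X"
    by (rule finite_subset[OF _ finite_fspace[of "{1..n}"]]) auto
  have "{x. codeword n D u x \<noteq> 0} = ?X - (?Y \<union> fill M ` (?Z - {0}))"
    unfolding removed[symmetric] by (auto simp: codeword_def D)
  then have "int (hamming_weight (codeword n D u)) = int (card ?X) - int (card (?Y \<union> fill M ` (?Z - {0})))"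
    using card_mono[OF finX subX] finite_subset[OF subX finX] subX
    by (simp add: hamming_weight_def card_Diff_subset of_nat_diff)
  also have "int (card (?Y \<union> fill M ` (?Z - {0}))) = int (card ?Y) + int (card (?Z - {0}))"
  proof -
    have "finite ?Y" "finite (fill M ` (?Z - {0}))" "?Y \<inter> fill M ` (?Z - {0}) = {}"
      using finite_subset[OF subX finX] fill_notin_fspace[OF disj] by auto
    then show ?thesis
      by (simp only: card_Un_disjoint Z of_nat_add)
  qed
  also have "int (card (?Z - {0})) = int (off_count B u ?s) - (if ?s \<noteq> 0 then 1 else 0)"
  proof (cases "?s = 0")
    case True
    then have "0 \<notin> ?Z" by simp
    then show ?thesis using True by (simp add: off_count_def)
  next
    case False
    then have "0 \<in> ?Z" by simp
    with finB have "card ?Z = Suc (card (?Z - {0}))"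
      by (intro card.remove) simp_all
    then have minus1: "int (card (?Z - {0})) = int (card ?Z) - 1"
      by linarith
    show ?thesis
      unfolding off_count_def minus1 using False by simp
  qed
  finally show ?thesis
    unfolding X Y by linarith
qed

lemma hamming_weight_codeword_cases:
  fixes u :: "nat \<Rightarrow> 'a::{field,finite}"
  assumes M: "M \<subseteq> {1..n}" and B: "B \<subseteq> {1..n}" and disj: "M \<inter> B = {}" and "B \<noteq> {}" "M \<noteq> {}"
    and D: "D = fspace {1..n} - (fspace M \<union> fill M ` (fspace B - {0}))"
    and u: "u \<in> fspace {1..n}" "u \<noteq> 0"
  defines "q \<equiv> int CARD('a)" and "s \<equiv> \<Sum>i\<in>M. u i"
  shows "int (hamming_weight (codeword n D u)) = (q - 1) * q ^ (n - 1)
    - (if \<exists>i\<in>M. u i \<noteq> 0 then (q - 1) * q ^ (card M - 1) else 0)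
    - (if \<exists>i\<in>B. u i \<noteq> 0 then (q - 1) * q ^ (card B - 1) else if s = 0 then 0 else q ^ card B)
    + (if s \<noteq> 0 then 1 else 0)"
proof -
  have fin: "finite M" "finite B"
    using M B finite_subset by blast+
  have "\<exists>i\<in>{1..n}. u i \<noteq> 0"
    using u by (simp add: fspace_eq_0_iff)
  then have "n > 0" by auto
  moreover have "card M > 0" "card B > 0"
    using fin assms by (auto simp: card_gt_0_iff)
  moreover have "q ^ k - q ^ (k - 1) = (q - 1) * q ^ (k - 1)" if "k > 0" for k
    using that by (cases k) (auto simp: algebra_simps)
  ultimately have "int (off_count {1..n} u 0) = (q - 1) * q ^ (n - 1)"
      "int (off_count M u 0) = (if \<exists>i\<in>M. u i \<noteq> 0 then (q - 1) * q ^ (card M - 1) else 0)"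
      "int (off_count B u s) = (if \<exists>i\<in>B. u i \<noteq> 0 then (q - 1) * q ^ (card B - 1)
        else if s = 0 then 0 else q ^ card B)"
    using \<open>\<exists>i\<in>{1..n}. u i \<noteq> 0\<close> by (auto simp: off_count_eq fin simp flip: q_def)
  then show ?thesis
    using hamming_weight_codeword[OF M B disj D, of u] by (simp only: s_def)
qed

text \<open>At least \<open>2 q^(n-1)\<close> points of the full space lie off the kernel of \<open>u\<close>, and strictly fewer
  of these are removed: at most \<open>q^|M| - 1\<close> from the coordinate space over \<open>M\<close>, and at most \<open>q^|B|\<close> others.\<close>
lemma hamming_weight_codeword_pos:
  fixes u :: "nat \<Rightarrow> 'a::{field,finite}"
  assumes M: "M \<subset> {1..n}" and B: "B \<subset> {1..n}" and disj: "M \<inter> B = {}"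
    and D: "D = fspace {1..n} - (fspace M \<union> fill M ` (fspace B - {0}))"
    and u: "u \<in> fspace {1..n}" "u \<noteq> 0" and q: "CARD('a) \<ge> 3"
  shows "hamming_weight (codeword n D u) > 0"
proof -
  let ?q = "int CARD('a)"
  have fin: "finite M" "finite B"
    using M B finite_subset by blast+
  have "card M < n" "card B < n"
    using psubset_card_mono[OF _ M] psubset_card_mono[OF _ B] by simp_all
  then have le: "?q ^ card M \<le> ?q ^ (n - 1)" "?q ^ card B \<le> ?q ^ (n - 1)"
    using q by (auto intro!: power_increasing)
  have pos: "?q ^ k > 0" for k
    using q by simp
  have "\<exists>i\<in>{1..n}. u i \<noteq> 0"
    using u by (simp add: fspace_eq_0_iff)
  moreover from this have "?q ^ n = ?q * ?q ^ (n - 1)"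
    by (cases n) auto
  moreover have "3 * ?q ^ (n - 1) \<le> ?q * ?q ^ (n - 1)"
    using q by (intro mult_right_mono) auto
  ultimately have "int (off_count {1..n} u 0) \<ge> 2 * ?q ^ (n - 1)"
    by (simp add: off_count_eq)
  moreover have "int (off_count M u 0) \<le> ?q ^ card M - 1"
    using pos[of "card M"] pos[of "card M - 1"] by (auto simp: off_count_eq fin)
  moreover have "int (off_count B u t) \<le> ?q ^ card B" for t
    using pos[of "card B"] pos[of "card B - 1"] by (auto simp: off_count_eq fin)
  ultimately show ?thesis
    using hamming_weight_codeword[OF _ _ disj D, of u] M B le
    by (smt (verit) of_nat_0_less_iff psubset_imp_subset)
qed

section \<open>Frequencies\<close>

lemma card_sum_nonzero:
  assumes "finite S" "S \<noteq> {}"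
  shows "int (card {v \<in> fspace S :: (nat \<Rightarrow> 'a::{field,finite}) set. sum v S \<noteq> 0})
    = int CARD('a) ^ card S - int CARD('a) ^ (card S - 1)"
  using off_count_eq[OF assms(1), of "\<lambda>_. 1 :: 'a" 0] assms(2) by (simp add: off_count_def)

lemma card_sum_zero:
  assumes "finite S" "S \<noteq> {}"
  shows "int (card {v \<in> fspace S :: (nat \<Rightarrow> 'a::{field,finite}) set. v \<noteq> 0 \<and> sum v S = 0})
    = int CARD('a) ^ (card S - 1) - 1"
proof -
  obtain j where "j \<in> S" using assms by blast
  let ?H = "{v \<in> fspace S :: (nat \<Rightarrow> 'a) set. sum v S = 0}"
  have "card ?H = CARD('a) ^ (card S - 1)"
    using card_hyperplane[OF assms(1) \<open>j \<in> S\<close>, of "\<lambda>_. 1 :: 'a" 0] by simp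
  moreover have "{v \<in> fspace S :: (nat \<Rightarrow> 'a) set. v \<noteq> 0 \<and> sum v S = 0} = ?H - {0}"
    by auto
  moreover have "0 \<in> ?H" by simp
  ultimately show ?thesis
    by (simp add: card_Diff_singleton of_nat_diff Suc_leI flip: of_nat_power)
qed

lemma card_proj_zero:
  assumes "finite E" "B \<subseteq> E"
  shows "int (card {w \<in> fspace E :: (nat \<Rightarrow> 'a::{field,finite}) set. proj B w = 0})
    = int CARD('a) ^ (card E - card B)"
proof -
  have "{w \<in> fspace E :: (nat \<Rightarrow> 'a) set. proj B w = 0} = fspace (E - B)"
    using assms(2) by (auto simp: proj_eq_0_iff fspace_def)
  moreover have "card (E - B) = card E - card B"
    using assms finite_subset by (intro card_Diff_subset) auto
  ultimately show ?thesis
    using assms by (simp add: card_fspace)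
qed

lemma card_proj_nonzero:
  assumes "finite E" "B \<subseteq> E"
  shows "int (card {w \<in> fspace E :: (nat \<Rightarrow> 'a::{field,finite}) set. proj B w \<noteq> 0})
    = int CARD('a) ^ card E - int CARD('a) ^ (card E - card B)"
proof -
  let ?Z = "{w \<in> fspace E :: (nat \<Rightarrow> 'a) set. proj B w = 0}"
  have fin: "finite (fspace E :: (nat \<Rightarrow> 'a) set)"
    using assms(1) by (rule finite_fspace)
  have "{w \<in> fspace E :: (nat \<Rightarrow> 'a) set. proj B w \<noteq> 0} = fspace E - ?Z"
    by auto
  moreover have "card ?Z \<le> card (fspace E :: (nat \<Rightarrow> 'a) set)"
    by (rule card_mono[OF fin]) auto
  ultimately have "int (card {w \<in> fspace E :: (nat \<Rightarrow> 'a) set. proj B w \<noteq> 0})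
      = int (card (fspace E :: (nat \<Rightarrow> 'a) set)) - int (card ?Z)"
    using fin by (simp add: card_Diff_subset of_nat_diff)
  then show ?thesis
    using card_proj_zero[OF assms, where 'a = 'a] assms(1) by (simp add: card_fspace)
qed

lemma weight_rowI:
  assumes "\<And>u. u \<in> fspace {1..n} \<Longrightarrow> u \<noteq> 0 \<Longrightarrow> P u \<Longrightarrow> int (hamming_weight (codeword n D u)) = w"
    and "int (card {u \<in> fspace {1..n}. u \<noteq> 0 \<and> P u}) = f"
  shows "weight_row n D P w f"
  using assms by (simp add: weight_row_def)

theorem theorem4p3:
  fixes p m n b :: nat and B :: "nat set" and I :: "nat multiset"
    and D :: "(nat \<Rightarrow> 'p::prime_card mod_ring) set"
  assumes "p = CARD('p)" and "prime p" and "odd p"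
    and "1 \<le> m" and "m < n"
    and "B \<subseteq> {1..n} - {1..m}" and "card B = b" and "1 \<le> b" and "b \<le> n - m"
    and "sat_ideal p (hier m n) n I"
    and "\<forall>i \<in> {1..m} \<union> B. count I i = p - 1"
    and "\<forall>i. i \<notin> {1..m} \<union> B \<longrightarrow> count I i = 0"
    and "D = fspace {1..n} - ideal_vectors (hier m n) n I"
  shows
    "let q = int p;
         Q = (q - 1) * q ^ (n - 1);
         c1 = q ^ (n - m - b);
         c0 = q ^ (n - m) - q ^ (n - m - b);
         v = (\<lambda>u :: nat \<Rightarrow> 'p mod_ring. proj {1..m} u);
         w = (\<lambda>u :: nat \<Rightarrow> 'p mod_ring. proj ({1..n} - {1..m}) u);
         \<sigma> = (\<lambda>u. \<Sum>i\<in>{1..m}. v u i);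
         \<delta> = (\<lambda>u. if proj B (w u) = 0 then 1 else 0 :: nat)
     in is_code D (nat (q ^ n - q ^ m - q ^ b + 1)) n (code n D)
      \<and> int (card D) = q ^ n - q ^ m - q ^ b + 1
      \<and> card (hamming_weight ` code n D - {0}) \<le> 6
      \<and> weight_row n D (\<lambda>u. v u = 0 \<and> \<delta> u = 1)
          Q
          (c1 - 1)
      \<and> weight_row n D (\<lambda>u. v u = 0 \<and> \<delta> u = 0)
          ((q - 1) * (q ^ (n - 1) - q ^ (b - 1)))
          c0
      \<and> weight_row n D (\<lambda>u. v u \<noteq> 0 \<and> \<sigma> u = 0 \<and> \<delta> u = 1)
          ((q - 1) * (q ^ (n - 1) - q ^ (m - 1)))
          ((q ^ (m - 1) - 1) * c1)
      \<and> weight_row n D (\<lambda>u. v u \<noteq> 0 \<and> \<sigma> u = 0 \<and> \<delta> u = 0)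
          ((q - 1) * (q ^ (n - 1) - q ^ (m - 1) - q ^ (b - 1)))
          ((q ^ (m - 1) - 1) * c0)
      \<and> weight_row n D (\<lambda>u. \<sigma> u \<noteq> 0 \<and> \<delta> u = 1)
          ((q - 1) * (q ^ (n - 1) - q ^ (m - 1)) - q ^ b + 1)
          ((q ^ m - q ^ (m - 1)) * c1)
      \<and> weight_row n D (\<lambda>u. \<sigma> u \<noteq> 0 \<and> \<delta> u = 0)
          ((q - 1) * (q ^ (n - 1) - q ^ (m - 1) - q ^ (b - 1)) + 1)
          ((q ^ m - q ^ (m - 1)) * c0)"
proof -
  define q where "q = int p"
  define M where "M = {1..m}"
  define E where "E = {1..n} - M"
  note p = \<open>p = CARD('p)\<close>
  have qp: "q = int CARD('p mod_ring)"
    by (simp add: q_def p)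
  have "p \<noteq> 2"
    using \<open>odd p\<close> by auto
  then have "p \<ge> 3"
    using \<open>prime p\<close> prime_ge_2_nat[of p] by simp
  have M: "finite M" "M \<noteq> {}" "card M = m" "M \<subset> {1..n}"
    using \<open>1 \<le> m\<close> \<open>m < n\<close> by (auto simp: M_def)
  have E: "finite E" "card E = n - m" "M \<inter> E = {}" "M \<union> E = {1..n}"
    using \<open>m < n\<close> by (auto simp: M_def E_def card_Diff_subset)
  have B: "finite B" "B \<noteq> {}" "B \<subseteq> E" "B \<subset> {1..n}" "M \<inter> B = {}"
  proof -
    show "B \<subseteq> E" using assms(6) by (simp only: E_def M_def)
    then show "B \<subset> {1..n}" "M \<inter> B = {}"
      using E(3,4) M(2) by blast+
    show "finite B" "B \<noteq> {}"
      using \<open>card B = b\<close> \<open>1 \<le> b\<close> card_gt_0_iff[of B] by auto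
  qed
  have D: "D = fspace {1..n} - (fspace M \<union> fill M ` (fspace B - {0}))"
    unfolding M_def assms(13)
    by (subst ideal_vectors_hier) (use assms in auto)
  have Msub: "M \<subseteq> {1..n}" and Bsub: "B \<subseteq> {1..n}"
    using M B by auto

  have finD: "finite D"
    unfolding D by (simp add: finite_fspace)
  have cardD: "int (card D) = q ^ n - q ^ m - q ^ b + 1"
  proof -
    let ?R = "fspace M \<union> fill M ` (fspace B - {0}) :: (nat \<Rightarrow> 'p mod_ring) set"
    have sub: "?R \<subseteq> fspace {1..n}"
      using fspace_mono[OF Msub] fill_in_fspace[OF Msub Bsub] by blast
    have fin: "finite (fspace {1..n} :: (nat \<Rightarrow> 'p mod_ring) set)"
      by (simp add: finite_fspace)
    have "int (card D) = int (card (fspace {1..n} :: (nat \<Rightarrow> 'p mod_ring) set)) - int (card ?R)"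
      unfolding D using fin sub finite_subset[OF sub fin]
      by (simp add: card_Diff_subset of_nat_diff card_mono)
    also have "int (card ?R) = q ^ m + q ^ b - 1"
      using card_removed[OF M(1) B(1) B(5), where 'a = "'p mod_ring"] M(3) \<open>card B = b\<close>
      unfolding qp by simp
    finally show ?thesis
      by (simp add: card_fspace q_def p)
  qed

  have weight: "int (hamming_weight (codeword n D u)) = (q - 1) * q ^ (n - 1)
      - (if proj M u \<noteq> 0 then (q - 1) * q ^ (m - 1) else 0)
      - (if proj B (proj E u) \<noteq> 0 then (q - 1) * q ^ (b - 1)
         else if (\<Sum>i\<in>M. proj M u i) = 0 then 0 else q ^ b)
      + (if (\<Sum>i\<in>M. proj M u i) \<noteq> 0 then 1 else 0)"
    if "u \<in> fspace {1..n}" "u \<noteq> 0" for u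
  proof -
    have "proj M u \<noteq> 0 \<longleftrightarrow> (\<exists>i\<in>M. u i \<noteq> 0)"
      by (simp add: proj_eq_0_iff)
    moreover have "proj B (proj E u) \<noteq> 0 \<longleftrightarrow> (\<exists>i\<in>B. u i \<noteq> 0)"
      using B(3) by (auto simp: proj_eq_0_iff) (auto simp: proj_def split: if_splits)
    moreover have "(\<Sum>i\<in>M. proj M u i) = (\<Sum>i\<in>M. u i)"
      by (simp add: proj_def)
    ultimately show ?thesis
      using hamming_weight_codeword_cases[OF Msub Bsub B(5) B(2) M(2) D that]
      unfolding qp M(3) \<open>card B = b\<close> by simp
  qed
  have sum_proj: "proj M u \<noteq> 0" if "(\<Sum>i\<in>M. proj M u i) \<noteq> 0" for u :: "nat \<Rightarrow> 'p mod_ring"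
    using that by force
  have pos: "hamming_weight (codeword n D u) > 0" if "u \<in> fspace {1..n}" "u \<noteq> 0" for u
    by (rule hamming_weight_codeword_pos[OF M(4) B(4) B(5) D that]) (use \<open>p \<ge> 3\<close> p in simp)

  have split: "card {u \<in> fspace {1..n}. P (proj M u) \<and> R (proj E u)}
      = card {v \<in> fspace M. P v} * card {w \<in> fspace E. R w}"
    for P R :: "(nat \<Rightarrow> 'p mod_ring) \<Rightarrow> bool"
    using card_fspace_split[OF E(3)] unfolding E(4) .
  have v0: "{v \<in> fspace M. v = 0} = {0 :: nat \<Rightarrow> 'p mod_ring}"
    by auto
  note counts = card_sum_nonzero[OF M(1,2), where 'a = "'p mod_ring", folded qp, unfolded M(3)]
    card_sum_zero[OF M(1,2), where 'a = "'p mod_ring", folded qp, unfolded M(3)]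
    card_proj_zero[OF E(1) B(3), where 'a = "'p mod_ring", folded qp, unfolded E(2) \<open>card B = b\<close>]
    card_proj_nonzero[OF E(1) B(3), where 'a = "'p mod_ring", folded qp, unfolded E(2) \<open>card B = b\<close>]
  let ?s = "\<lambda>u :: nat \<Rightarrow> 'p mod_ring. \<Sum>i\<in>M. proj M u i"
  let ?d = "\<lambda>u :: nat \<Rightarrow> 'p mod_ring. proj B (proj E u) = 0"

  have row1: "weight_row n D (\<lambda>u. proj M u = 0 \<and> ?d u) ((q - 1) * q ^ (n - 1)) (q ^ (n - m - b) - 1)"
  proof (rule weight_rowI)
    let ?U = "{u \<in> fspace {1..n} :: (nat \<Rightarrow> 'p mod_ring) set. proj M u = 0 \<and> ?d u}"
    have "int (card ?U) = q ^ (n - m - b)"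
      by (subst split) (simp add: v0 counts)
    moreover have "finite ?U"
      by (simp add: finite_fspace)
    moreover have "0 \<in> ?U"
      by (simp add: proj_eq_0_iff) (simp add: proj_def)
    ultimately have "int (card (?U - {0})) = q ^ (n - m - b) - 1"
      using card.remove[of ?U 0] by simp
    moreover have "{u \<in> fspace {1..n}. u \<noteq> 0 \<and> proj M u = 0 \<and> ?d u} = ?U - {0}"
      by auto
    ultimately show "int (card {u \<in> fspace {1..n}. u \<noteq> 0 \<and> proj M u = 0 \<and> ?d u})
        = q ^ (n - m - b) - 1"
      by simp
  qed (simp add: weight)
  \<comment> \<open>In the other rows the condition already excludes \<open>u = 0\<close>.\<close>
  have nz: "{u \<in> fspace {1..n}. u \<noteq> 0 \<and> P u} = {u \<in> fspace {1..n}. P u}"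
    if "\<not> P 0" for P :: "(nat \<Rightarrow> 'p mod_ring) \<Rightarrow> bool"
    using that by auto
  have proj0: "proj S 0 = (0 :: nat \<Rightarrow> 'p mod_ring)" for S
    by (simp add: proj_eq_0_iff)
  have row2: "weight_row n D (\<lambda>u. proj M u = 0 \<and> \<not> ?d u)
      ((q - 1) * (q ^ (n - 1) - q ^ (b - 1))) (q ^ (n - m) - q ^ (n - m - b))"
    by (rule weight_rowI, simp add: weight algebra_simps,
        subst nz, simp add: proj0, subst split, simp add: v0 counts)
  have row3: "weight_row n D (\<lambda>u. proj M u \<noteq> 0 \<and> ?s u = 0 \<and> ?d u)
      ((q - 1) * (q ^ (n - 1) - q ^ (m - 1))) ((q ^ (m - 1) - 1) * q ^ (n - m - b))"
    by (rule weight_rowI, simp add: weight algebra_simps,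
        subst nz, simp add: proj0, subst conj_assoc[symmetric], subst split, simp add: counts)
  have row4: "weight_row n D (\<lambda>u. proj M u \<noteq> 0 \<and> ?s u = 0 \<and> \<not> ?d u)
      ((q - 1) * (q ^ (n - 1) - q ^ (m - 1) - q ^ (b - 1)))
      ((q ^ (m - 1) - 1) * (q ^ (n - m) - q ^ (n - m - b)))"
    by (rule weight_rowI, simp add: weight algebra_simps,
        subst nz, simp add: proj0, subst conj_assoc[symmetric], subst split, simp add: counts)
  have row5: "weight_row n D (\<lambda>u. ?s u \<noteq> 0 \<and> ?d u)
      ((q - 1) * (q ^ (n - 1) - q ^ (m - 1)) - q ^ b + 1)
      ((q ^ m - q ^ (m - 1)) * q ^ (n - m - b))"
    by (rule weight_rowI, simp add: weight sum_proj algebra_simps,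
        subst nz, simp add: proj0, subst split, simp add: counts)
  have row6: "weight_row n D (\<lambda>u. ?s u \<noteq> 0 \<and> \<not> ?d u)
      ((q - 1) * (q ^ (n - 1) - q ^ (m - 1) - q ^ (b - 1)) + 1)
      ((q ^ m - q ^ (m - 1)) * (q ^ (n - m) - q ^ (n - m - b)))"
    by (rule weight_rowI, simp add: weight sum_proj algebra_simps,
        subst nz, simp add: proj0, subst split, simp add: counts)

  have "is_code D (card D) n (code n D)"
  proof (rule is_code_code[OF finD], rule ccontr)
    fix u :: "nat \<Rightarrow> 'p mod_ring"
    assume "u \<in> fspace {1..n}" "codeword n D u = 0" "u \<noteq> 0"
    with pos[of u] show False
      by (simp add: hamming_weight_def)
  qed
  then have code: "is_code D (nat (q ^ n - q ^ m - q ^ b + 1)) n (code n D)"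
    by (simp flip: cardD)

  have six: "card (hamming_weight ` code n D - {0}) \<le> 6"
  proof -
    define W where "W = map nat [(q - 1) * q ^ (n - 1), (q - 1) * (q ^ (n - 1) - q ^ (b - 1)),
      (q - 1) * (q ^ (n - 1) - q ^ (m - 1)), (q - 1) * (q ^ (n - 1) - q ^ (m - 1) - q ^ (b - 1)),
      (q - 1) * (q ^ (n - 1) - q ^ (m - 1)) - q ^ b + 1,
      (q - 1) * (q ^ (n - 1) - q ^ (m - 1) - q ^ (b - 1)) + 1]"
    have "hamming_weight (codeword n D u) \<in> set W \<union> {0}" if u: "u \<in> fspace {1..n}" for u
    proof (cases "u = 0")
      case True
      then show ?thesis
        by (simp add: hamming_weight_def codeword_def dot_def)
    next
      case False
      have row: "hamming_weight (codeword n D u) = nat w" if "weight_row n D P w f" "P u" for P w f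
        using that u False by (auto simp: weight_row_def)
      show ?thesis
      proof (cases "?s u = 0")
        case True
        then show ?thesis
          using row[OF row1] row[OF row2] row[OF row3] row[OF row4]
          by (cases "proj M u = 0"; cases "?d u") (simp_all add: W_def)
      next
        case False
        then show ?thesis
          using row[OF row5] row[OF row6] by (cases "?d u") (simp_all add: W_def)
      qed
    qed
    then have "hamming_weight ` code n D - {0} \<subseteq> set W"
      by (auto simp: code_def)
    then have "card (hamming_weight ` code n D - {0}) \<le> card (set W)"
      by (intro card_mono) auto
    also have "\<dots> \<le> 6"
      using card_length[of W] by (simp add: W_def)
    finally show ?thesis .
  qed

  have delta: "((if c then 1 else 0 :: nat) = 1) = c" "((if c then 1 else 0 :: nat) = 0) = (\<not> c)" for c
    by auto
  show ?thesis
    unfolding Let_def delta q_def[symmetric] M_def[symmetric] E_def[symmetric]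
    by (intro conjI code cardD six row1 row2 row3 row4 row5 row6)
qed

end
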